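(* Let $d\in\{2,3\}$, $\mu>0$, and let $(\mathbf u,\theta)$ with $\theta>0$ be a smooth solution on $[0,\infty)\times\mathbb T^d$ of $$\mathbf u_{tt}-\Delta\mathbf u=-\mu\nabla\theta,\qquad \theta_t-\Delta\theta=-\mu\theta\operatorname{div}\mathbf u_t,\qquad \mathbf u(0)=\mathbf u_0,\ \mathbf u_t(0)=\mathbf v_0,\ \theta(0)=\theta_0.$$ Then $$\mathcal F(\mathbf u_0,\theta_0)\le D\ \implies\ \mathcal F(\mathbf u(\cdot,t),\theta(\cdot,t))\le\mathcal F(\mathbf u_0,\theta_0)\quad\text{for all }t\in(0,\infty),$$ where $\mathcal F$ and the constant $D>0$ are as described in the context.
   Context: $\mathbb T^d$ is the $d$-dimensional torus, $\mathbf u$ is $\mathbb R^d$-valued, $\theta$ scalar. The functional is $$\mathcal F(\mathbf u,\theta):=\frac12\Big(\int_{\mathbb T^d}|\nabla\mathbf u_t|^2dx+\int_{\mathbb T^d}|\Delta\mathbf u|^2dx+\int_{\mathbb T^d}\frac{|\nabla\theta|^2}{\theta}dx\Big),$$ and $\mathcal F(\mathbf u_0,\theta_0)$ denotes its value at time $0$ (with $\mathbf u_t(0)=\mathbf v_0$). The constant $D>0$ depends only on $d,\mu,\mathbb T^d$ and is such that, for some $C>0$ depending only on $d,\mu,\mathbb T^d$, every smooth solution of the system with $\theta>0$ satisfies $\frac{d}{dt}\mathcal F\le C\|\nabla^2\theta^{1/2}\|_{L^2(\mathbb T^d)}^2(\mathcal F-D)$. *)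

theory Defs
  imports "HOL-Analysis.Analysis"
begin

text \<open>
  The torus of dimension \<open>CARD('n)\<close> is \<open>(\<real> / L\<int>)\<^sup>d\<close> with an arbitrary side length \<open>L > 0\<close>. Functions on it
  are functions on \<open>real ^ 'n\<close> that are \<open>L\<close>-periodic in every coordinate, and integrals over it are
  integrals over the cell \<open>[0, L]\<^sup>d\<close>. A space-time field is a function \<open>real \<Rightarrow> real ^ 'n \<Rightarrow> 'b\<close> (time
  first) of which only the values at times \<open>t \<ge> 0\<close> matter.
\<close>

definition torus_cell :: "real \<Rightarrow> (real ^ 'n) set" where
  "torus_cell L = cbox 0 (\<chi> i. L)"

definition torus_periodic :: "real \<Rightarrow> (real ^ 'n \<Rightarrow> 'b) \<Rightarrow> bool" where
  "torus_periodic L f \<longleftrightarrow> (\<forall>i x. f (x + axis i L) = f x)"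

text \<open>
  Derivatives are taken within \<open>S\<close>, hence one-sided at boundary points. We use this only for
  \<open>S = [0, \<infinity>) \<times> real ^ 'n\<close>, where the derivative within \<open>S\<close> is unique.
\<close>

primrec C_k_on :: "nat \<Rightarrow> 'a::real_normed_vector set \<Rightarrow> ('a \<Rightarrow> 'b::real_normed_vector) \<Rightarrow> bool" where
  "C_k_on 0 S f \<longleftrightarrow> continuous_on S f"
| "C_k_on (Suc k) S f \<longleftrightarrow>
     (\<exists>f'. (\<forall>p\<in>S. (f has_derivative f' p) (at p within S)) \<and> (\<forall>v. C_k_on k S (\<lambda>p. f' p v)))"

definition smooth_on :: "'a::real_normed_vector set \<Rightarrow> ('a \<Rightarrow> 'b::real_normed_vector) \<Rightarrow> bool" where
  "smooth_on S f \<longleftrightarrow> (\<forall>k. C_k_on k S f)"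

definition smooth_torus_field ::
    "real \<Rightarrow> (real \<Rightarrow> real ^ 'n \<Rightarrow> 'b::real_normed_vector) \<Rightarrow> bool" where
  "smooth_torus_field L f \<longleftrightarrow>
     smooth_on ({0..} \<times> UNIV) (\<lambda>(t, x). f t x) \<and> (\<forall>t\<ge>0. torus_periodic L (f t))"

definition dt :: "(real \<Rightarrow> real ^ 'n \<Rightarrow> 'b::real_normed_vector) \<Rightarrow> real \<Rightarrow> real ^ 'n \<Rightarrow> 'b" where
  "dt f t x = vector_derivative (\<lambda>s. f s x) (at t within {0..})"

definition partial :: "'n \<Rightarrow> (real ^ 'n \<Rightarrow> 'b::real_normed_vector) \<Rightarrow> real ^ 'n \<Rightarrow> 'b" where
  "partial i f x = frechet_derivative f (at x) (axis i 1)"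

definition grad :: "(real ^ 'n \<Rightarrow> real) \<Rightarrow> real ^ 'n \<Rightarrow> real ^ 'n" where
  "grad f x = (\<chi> i. partial i f x)"

definition divergence :: "(real ^ 'n \<Rightarrow> real ^ 'n) \<Rightarrow> real ^ 'n \<Rightarrow> real" where
  "divergence w x = (\<Sum>i\<in>UNIV. partial i w x $ i)"

definition laplacian :: "(real ^ 'n \<Rightarrow> 'b::real_normed_vector) \<Rightarrow> real ^ 'n \<Rightarrow> 'b" where
  "laplacian f x = (\<Sum>i\<in>UNIV. partial i (partial i f) x)"

text \<open>\<open>|\<nabla>w|\<^sup>2\<close> for a vector field and \<open>|\<nabla>\<^sup>2f|\<^sup>2\<close> for a scalar field, both in the Frobenius norm.\<close>

definition jacobian_norm_sq :: "(real ^ 'n \<Rightarrow> real ^ 'n) \<Rightarrow> real ^ 'n \<Rightarrow> real" where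
  "jacobian_norm_sq w x = (\<Sum>i\<in>UNIV. \<Sum>j\<in>UNIV. (partial i w x $ j)\<^sup>2)"

definition hessian_norm_sq :: "(real ^ 'n \<Rightarrow> real) \<Rightarrow> real ^ 'n \<Rightarrow> real" where
  "hessian_norm_sq f x = (\<Sum>i\<in>UNIV. \<Sum>j\<in>UNIV. (partial i (partial j f) x)\<^sup>2)"

definition hessian_L2_sq :: "real \<Rightarrow> (real ^ 'n \<Rightarrow> real) \<Rightarrow> real" where
  "hessian_L2_sq L f = integral (torus_cell L) (hessian_norm_sq f)"

text \<open>The functional at a fixed time; the argument \<open>v\<close> stands for the velocity \<open>u\<^sub>t\<close> at that time.\<close>

definition calF ::
    "real \<Rightarrow> (real ^ 'n \<Rightarrow> real ^ 'n) \<Rightarrow> (real ^ 'n \<Rightarrow> real ^ 'n) \<Rightarrow> (real ^ 'n \<Rightarrow> real) \<Rightarrow> real" where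
  "calF L u v \<theta> = 1 / 2 *
     (integral (torus_cell L) (jacobian_norm_sq v)
      + integral (torus_cell L) (\<lambda>x. (norm (laplacian u x))\<^sup>2)
      + integral (torus_cell L) (\<lambda>x. (norm (grad \<theta> x))\<^sup>2 / \<theta> x))"

definition smooth_positive_solution ::
    "real \<Rightarrow> real \<Rightarrow> (real \<Rightarrow> real ^ 'n \<Rightarrow> real ^ 'n) \<Rightarrow> (real \<Rightarrow> real ^ 'n \<Rightarrow> real) \<Rightarrow> bool" where
  "smooth_positive_solution L \<mu> u \<theta> \<longleftrightarrow>
     smooth_torus_field L u \<and> smooth_torus_field L \<theta> \<and>
     (\<forall>t\<ge>0. \<forall>x. \<theta> t x > 0 \<and>
        dt (dt u) t x - laplacian (u t) x = - \<mu> *\<^sub>R grad (\<theta> t) x \<and>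
        dt \<theta> t x - laplacian (\<theta> t) x = - \<mu> * \<theta> t x * divergence (dt u t) x)"

text \<open>
  The defining property of the threshold \<open>D\<close>. The dimension enters only through the type argument,
  and \<open>C\<close> is chosen before the solution, so \<open>C\<close> and \<open>D\<close> depend on \<open>d\<close>, \<open>\<mu>\<close> and the torus alone.
  Along a smooth positive solution the functional is differentiable in time, so \<open>deriv\<close> is the
  genuine derivative.
\<close>

definition admissible_threshold :: "'n::finite itself \<Rightarrow> real \<Rightarrow> real \<Rightarrow> real \<Rightarrow> bool" where
  "admissible_threshold _ L \<mu> D \<longleftrightarrow> D > 0 \<and>
     (\<exists>C>0. \<forall>(u :: real \<Rightarrow> real ^ 'n \<Rightarrow> real ^ 'n) \<theta>. smooth_positive_solution L \<mu> u \<theta> \<longrightarrow>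
        (\<forall>t>0. deriv (\<lambda>s. calF L (u s) (dt u s) (\<theta> s)) t
           \<le> C * hessian_L2_sq L (\<lambda>x. sqrt (\<theta> t x)) * (calF L (u t) (dt u t) (\<theta> t) - D)))"

end

(*
  The hypothesis on D is the linear differential inequality F' <= a (F - D) with a >= 0. Since F is
  continuous up to t = 0 and a is bounded on bounded time intervals, Gronwall's inequality propagates
  F <= D from t = 0 to all later times; then F' <= 0, so F decreases. Smoothness enters twice: it
  makes F differentiable under the integral sign, so that "deriv" in the hypothesis is not a junk
  value, and it bounds a, because the Hessian of the square root of the temperature is an explicit
  expression in derivatives of the temperature, hence continuous in space-time.
*)
theory Submission
  imports Defs
begin

section \<open>Derivatives on the closed half-space of nonnegative times\<close>

text \<open>Derivatives within \<open>S\<close> see only the values on \<open>S\<close>. This allows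
  a derivative field to be replaced by \<open>dt\<close> or \<open>partial\<close>, with which it is
  only known to agree at times \<open>t \<ge> 0\<close>.\<close>

lemma C_k_on_cong:
  assumes "\<And>p. p \<in> S \<Longrightarrow> f p = g p" and "C_k_on k S f"
  shows "C_k_on k S g"
proof (cases k)
  case 0
  with assms show ?thesis
    by (simp cong: continuous_on_cong)
next
  case (Suc m)
  with assms(2) obtain f' where "\<forall>p\<in>S. (f has_derivative f' p) (at p within S)"
    and "\<forall>v. C_k_on m S (\<lambda>p. f' p v)"
    by auto
  moreover from this(1) have "\<forall>p\<in>S. (g has_derivative f' p) (at p within S)"
    using assms(1) by (metis has_derivative_transform)
  ultimately show ?thesis
    using Suc by auto
qed

text \<open>Basis vectors have time component 0 or 1, so a small positive step along any of them
  stays in the half-space, even from a point with \<open>t = 0\<close>. That is enough for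
  uniqueness of the derivative.\<close>

lemma half_space_derivative_unique:
  fixes f :: "real \<times> (real ^ 'n) \<Rightarrow> 'b::real_normed_vector"
  assumes "(f has_derivative A) (at p within {0..} \<times> UNIV)"
    and "(f has_derivative B) (at p within {0..} \<times> UNIV)" and "p \<in> {0..} \<times> UNIV"
  shows "A = B"
proof (rule frechet_derivative_unique_within[OF assms(1,2)])
  fix i :: "real \<times> (real ^ 'n)" and e :: real
  assume "i \<in> Basis" "e > 0"
  moreover from this(1) have "fst i \<ge> 0"
    by (auto simp: Basis_prod_def)
  ultimately show "\<exists>d. 0 < \<bar>d\<bar> \<and> \<bar>d\<bar> < e \<and> p + d *\<^sub>R i \<in> {0..} \<times> UNIV"
    using assms(3) by (intro exI[of _ "e / 2"]) (auto simp: mem_Times_iff)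
qed

text \<open>\<open>C_k_on\<close> hides its derivative behind an existential, so each order could
  come with a different witness. Uniqueness identifies all of them with the one taken at order
  1.\<close>

lemma smooth_on_half_space_derivative:
  fixes f :: "real \<times> (real ^ 'n) \<Rightarrow> 'b::real_normed_vector"
  assumes "smooth_on ({0..} \<times> UNIV) f"
  obtains f' where "\<And>p. p \<in> {0..} \<times> UNIV \<Longrightarrow> (f has_derivative f' p) (at p within {0..} \<times> UNIV)"
    and "\<And>v. smooth_on ({0..} \<times> UNIV) (\<lambda>p. f' p v)"
proof -
  let ?S = "{0..} \<times> UNIV :: (real \<times> (real ^ 'n)) set"
  have "C_k_on (Suc 0) ?S f"
    using assms unfolding smooth_on_def by blast
  then obtain f' where f': "\<And>p. p \<in> ?S \<Longrightarrow> (f has_derivative f' p) (at p within ?S)"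
    by auto
  have "C_k_on k ?S (\<lambda>p. f' p v)" for k v
  proof -
    have "C_k_on (Suc k) ?S f"
      using assms unfolding smooth_on_def by blast
    then obtain g where g: "\<And>p. p \<in> ?S \<Longrightarrow> (f has_derivative g p) (at p within ?S)"
      and "C_k_on k ?S (\<lambda>p. g p v)"
      unfolding C_k_on.simps by blast
    moreover have "g p = f' p" if "p \<in> ?S" for p
      using half_space_derivative_unique[OF g f'] that by blast
    ultimately show ?thesis
      using C_k_on_cong[of ?S "\<lambda>p. g p v" "\<lambda>p. f' p v" k] by auto
  qed
  then show thesis
    using that[of f'] f' unfolding smooth_on_def by blast
qed

text \<open>The smoothness clause of \<open>smooth_torus_field\<close>, isolated so that closure
  under \<open>dt\<close> and \<open>partial\<close> can be stated and iterated.\<close>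

definition smooth_field :: "(real \<Rightarrow> real ^ 'n \<Rightarrow> 'b::real_normed_vector) \<Rightarrow> bool" where
  "smooth_field f \<longleftrightarrow> smooth_on ({0..} \<times> UNIV) (\<lambda>(t, x). f t x)"

text \<open>Chain rule along the embeddings \<open>y \<mapsto> (t, y)\<close> and
  \<open>s \<mapsto> (s, x)\<close>. A time slice is a full space, so the spatial derivative is
  unrestricted; the time derivative remains one-sided at \<open>t = 0\<close>.\<close>

lemma smooth_field_derivative:
  fixes f :: "real \<Rightarrow> real ^ 'n \<Rightarrow> 'b::real_normed_vector"
  assumes "smooth_field f"
  obtains f' :: "real \<Rightarrow> real ^ 'n \<Rightarrow> real \<times> (real ^ 'n) \<Rightarrow> 'b" where
      "\<And>v. smooth_on ({0..} \<times> UNIV) (\<lambda>(t, x). f' t x v)"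
    and "\<And>t x. t \<ge> 0 \<Longrightarrow> (f t has_derivative (\<lambda>h. f' t x (0, h))) (at x)"
    and "\<And>t x. t \<ge> 0 \<Longrightarrow> ((\<lambda>s. f s x) has_vector_derivative f' t x (1, 0)) (at t within {0..})"
proof -
  let ?S = "{0..} \<times> UNIV :: (real \<times> (real ^ 'n)) set"
  obtain F where F: "\<And>p. p \<in> ?S \<Longrightarrow> ((\<lambda>(t, x). f t x) has_derivative F p) (at p within ?S)"
    and smooth: "\<And>v. smooth_on ?S (\<lambda>p. F p v)"
    using smooth_on_half_space_derivative assms unfolding smooth_field_def by blast
  have space: "(f t has_derivative (\<lambda>h. F (t, x) (0, h))) (at x)" if "t \<ge> 0" for t x
  proof -
    have "((\<lambda>y. (t, y)) has_derivative (\<lambda>h. (0, h))) (at x)"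
      by (auto intro!: derivative_eq_intros)
    moreover have "((\<lambda>(t, x). f t x) has_derivative F (t, x)) (at (t, x) within range (\<lambda>y. (t, y)))"
      by (rule has_derivative_subset[OF F]) (use that in auto)
    ultimately show ?thesis
      using diff_chain_within[of "\<lambda>y. (t, y)" "\<lambda>h. (0, h)" x UNIV "\<lambda>(t, x). f t x" "F (t, x)"]
      by (simp add: o_def)
  qed
  have time: "((\<lambda>s. f s x) has_vector_derivative F (t, x) (1, 0)) (at t within {0..})"
    if "t \<ge> 0" for t x
  proof -
    have "((\<lambda>s. (s, x)) has_derivative (\<lambda>h. (h, 0))) (at t within {0..})"
      by (auto intro!: derivative_eq_intros)
    moreover have "((\<lambda>(t, x). f t x) has_derivative F (t, x)) (at (t, x) within (\<lambda>s. (s, x)) ` {0..})"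
      by (rule has_derivative_subset[OF F]) (use that in auto)
    ultimately have *: "((\<lambda>s. f s x) has_derivative (\<lambda>h. F (t, x) (h, 0))) (at t within {0..})"
      using diff_chain_within[of "\<lambda>s. (s, x)" "\<lambda>h. (h, 0)" t "{0..}" "\<lambda>(t, x). f t x" "F (t, x)"]
      by (simp add: o_def)
    interpret linear "F (t, x)"
      using F[of "(t, x)"] that by (simp add: has_derivative_linear)
    have "(\<lambda>h. F (t, x) (h, 0)) = (\<lambda>h. h *\<^sub>R F (t, x) (1, 0))"
    proof
      show "F (t, x) (h, 0) = h *\<^sub>R F (t, x) (1, 0)" for h
        using scale[of h "(1, 0)"] by simp
    qed
    from *[unfolded this] show ?thesis
      unfolding has_vector_derivative_def .
  qed
  show thesis
  proof (rule that[of "\<lambda>t x. F (t, x)"])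
    show "smooth_on ?S (\<lambda>(t, x). F (t, x) v)" for v
      using smooth[of v] by (simp add: case_prod_unfold)
  qed (use space time in auto)
qed

lemma smooth_on_cong:
  "(\<And>p. p \<in> S \<Longrightarrow> f p = g p) \<Longrightarrow> smooth_on S f \<Longrightarrow> smooth_on S g"
  unfolding smooth_on_def using C_k_on_cong by blast

lemma at_within_Ici_nontrivial:
  fixes a :: real
  assumes "t \<ge> a"
  shows "at t within {a..} \<noteq> bot"
proof -
  have "at_right t \<le> at t within {a..}"
    using assms by (intro at_le) auto
  then show ?thesis
    using trivial_limit_at_right_real[of t] by (metis bot.extremum_uniqueI)
qed

text \<open>For \<open>t \<ge> 0\<close>, \<open>dt\<close> and \<open>partial\<close> are the
  space-time derivative in the directions \<open>(1, 0)\<close> and \<open>(0, axis i 1)\<close>,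
  hence inherit its smoothness.\<close>

lemma
  fixes f :: "real \<Rightarrow> real ^ 'n \<Rightarrow> 'b::real_normed_vector"
  assumes "smooth_field f"
  shows smooth_field_dt: "smooth_field (dt f)"
    and has_vector_derivative_dt:
      "t \<ge> 0 \<Longrightarrow> ((\<lambda>s. f s x) has_vector_derivative dt f t x) (at t within {0..})"
    and smooth_field_partial: "smooth_field (\<lambda>t. partial i (f t))"
    and smooth_field_has_derivative:
      "t \<ge> 0 \<Longrightarrow> (f t has_derivative frechet_derivative (f t) (at x)) (at x)"
proof -
  obtain f' :: "real \<Rightarrow> real ^ 'n \<Rightarrow> real \<times> (real ^ 'n) \<Rightarrow> 'b" where
      smooth: "\<And>v. smooth_on ({0..} \<times> UNIV) (\<lambda>(t, x). f' t x v)"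
    and space: "\<And>t x. t \<ge> 0 \<Longrightarrow> (f t has_derivative (\<lambda>h. f' t x (0, h))) (at x)"
    and time: "\<And>t x. t \<ge> 0 \<Longrightarrow>
      ((\<lambda>s. f s x) has_vector_derivative f' t x (1, 0)) (at t within {0..})"
    by (rule smooth_field_derivative[OF assms]) (rule that)
  have dt: "f' t x (1, 0) = dt f t x" if "t \<ge> 0" for t x
    unfolding dt_def using vector_derivative_within[OF at_within_Ici_nontrivial time] that by metis
  have partial: "f' t x (0, axis i 1) = partial i (f t) x" if "t \<ge> 0" for t x
    unfolding partial_def using frechet_derivative_at[OF space[OF that]] by metis
  show "smooth_field (dt f)"
    unfolding smooth_field_def
    by (rule smooth_on_cong[OF _ smooth[of "(1, 0)"]]) (auto simp: dt)
  show "smooth_field (\<lambda>t. partial i (f t))"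
    unfolding smooth_field_def
    by (rule smooth_on_cong[OF _ smooth[of "(0, axis i 1)"]]) (auto simp: partial)
  show "t \<ge> 0 \<Longrightarrow> ((\<lambda>s. f s x) has_vector_derivative dt f t x) (at t within {0..})"
    using time dt by metis
  show "t \<ge> 0 \<Longrightarrow> (f t has_derivative frechet_derivative (f t) (at x)) (at x)"
    using space frechet_derivative_works differentiableI by metis
qed

lemma smooth_field_continuous_on:
  assumes "smooth_field f"
  shows "continuous_on ({0..} \<times> UNIV) (\<lambda>p. f (fst p) (snd p))"
proof -
  have "C_k_on 0 ({0..} \<times> UNIV) (\<lambda>(t, x). f t x)"
    using assms unfolding smooth_field_def smooth_on_def by (rule spec)
  then show ?thesis
    by (simp add: case_prod_beta)
qed

section \<open>Differentiability of the functional in time\<close>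

text \<open>The regularity that the Leibniz rule asks of an integrand. Unlike smoothness of all
  orders, it passes to squares, sums and quotients by writing down one explicit time
  derivative.\<close>

definition t_C1 :: "(real \<Rightarrow> real ^ 'n \<Rightarrow> real) \<Rightarrow> bool" where
  "t_C1 g \<longleftrightarrow> continuous_on ({0..} \<times> UNIV) (\<lambda>p. g (fst p) (snd p)) \<and>
     (\<exists>g'. continuous_on ({0..} \<times> UNIV) (\<lambda>p. g' (fst p) (snd p)) \<and>
       (\<forall>t\<ge>0. \<forall>x. ((\<lambda>s. g s x) has_real_derivative g' t x) (at t within {0..})))"

lemma t_C1_smooth_field:
  assumes "smooth_field f"
  shows "t_C1 f"
  unfolding t_C1_def has_real_derivative_iff_has_vector_derivative
  using smooth_field_continuous_on[OF assms] has_vector_derivative_dt[OF assms]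
    smooth_field_continuous_on[OF smooth_field_dt[OF assms]]
  by (intro conjI exI[of _ "dt f"]) auto

lemma t_C1_smooth_field_nth:
  assumes "smooth_field f"
  shows "t_C1 (\<lambda>t x. f t x $ j)"
proof -
  have "((\<lambda>s. f s x $ j) has_real_derivative dt f t x $ j) (at t within {0..})" if "t \<ge> 0" for t x
    unfolding has_real_derivative_iff_has_vector_derivative
    using bounded_linear.has_vector_derivative[OF bounded_linear_vec_nth
        has_vector_derivative_dt[OF assms that]] .
  then show ?thesis
    unfolding t_C1_def
    using smooth_field_continuous_on[OF assms]
      smooth_field_continuous_on[OF smooth_field_dt[OF assms]]
    by (intro conjI exI[of _ "\<lambda>t x. dt f t x $ j"]) (auto intro: continuous_on_component)
qed

lemma t_C1_power2:
  assumes "t_C1 f"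
  shows "t_C1 (\<lambda>t x. (f t x)\<^sup>2)"
proof -
  obtain f' where c: "continuous_on ({0..} \<times> UNIV) (\<lambda>p. f (fst p) (snd p))"
      "continuous_on ({0..} \<times> UNIV) (\<lambda>p. f' (fst p) (snd p))"
    and d: "\<And>t x. t \<ge> 0 \<Longrightarrow> ((\<lambda>s. f s x) has_real_derivative f' t x) (at t within {0..})"
    using assms unfolding t_C1_def by blast
  show ?thesis
    unfolding t_C1_def
    by (intro conjI exI[of _ "\<lambda>t x. 2 * f t x * f' t x"] allI impI)
      (auto intro!: continuous_intros derivative_eq_intros c d)
qed

lemma t_C1_divide:
  assumes "t_C1 f" and "t_C1 g" and pos: "\<And>t x. t \<ge> 0 \<Longrightarrow> g t x > 0"
  shows "t_C1 (\<lambda>t x. f t x / g t x)"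
proof -
  obtain f' where c: "continuous_on ({0..} \<times> UNIV) (\<lambda>p. f (fst p) (snd p))"
      "continuous_on ({0..} \<times> UNIV) (\<lambda>p. f' (fst p) (snd p))"
    and d: "\<And>t x. t \<ge> 0 \<Longrightarrow> ((\<lambda>s. f s x) has_real_derivative f' t x) (at t within {0..})"
    using assms(1) unfolding t_C1_def by blast
  obtain g' where c': "continuous_on ({0..} \<times> UNIV) (\<lambda>p. g (fst p) (snd p))"
      "continuous_on ({0..} \<times> UNIV) (\<lambda>p. g' (fst p) (snd p))"
    and d': "\<And>t x. t \<ge> 0 \<Longrightarrow> ((\<lambda>s. g s x) has_real_derivative g' t x) (at t within {0..})"
    using assms(2) unfolding t_C1_def by blast
  have nz: "g t x \<noteq> 0" if "t \<ge> 0" for t x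
    using pos[OF that, of x] by simp
  show ?thesis
    unfolding t_C1_def
    by (intro conjI exI[of _ "\<lambda>t x. (f' t x * g t x - f t x * g' t x) / (g t x * g t x)"] allI impI)
      (auto intro!: continuous_intros DERIV_divide c c' d d' simp: nz)
qed

lemma t_C1_sum:
  assumes "\<And>i. i \<in> I \<Longrightarrow> t_C1 (f i)"
  shows "t_C1 (\<lambda>t x. \<Sum>i\<in>I. f i t x)"
proof -
  have "\<forall>i\<in>I. \<exists>f'. continuous_on ({0..} \<times> UNIV) (\<lambda>p. f' (fst p) (snd p)) \<and>
      (\<forall>t\<ge>0. \<forall>x. ((\<lambda>s. f i s x) has_real_derivative f' t x) (at t within {0..}))"
    using assms unfolding t_C1_def by (intro ballI) (elim meta_allE meta_impE conjE)
  \<comment> \<open>One time derivative is chosen for every index at once, so that their sum can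
    serve as the witness.\<close>
  from bchoice[OF this] obtain f' where
      c: "\<And>i. i \<in> I \<Longrightarrow> continuous_on ({0..} \<times> UNIV) (\<lambda>p. f' i (fst p) (snd p))"
    and d: "\<And>i t x. i \<in> I \<Longrightarrow> t \<ge> 0 \<Longrightarrow>
      ((\<lambda>s. f i s x) has_real_derivative f' i t x) (at t within {0..})"
    by blast
  have "continuous_on ({0..} \<times> UNIV) (\<lambda>p. f i (fst p) (snd p))" if "i \<in> I" for i
    using assms[OF that] unfolding t_C1_def by (rule conjunct1)
  with c d show ?thesis
    unfolding t_C1_def
    by (intro conjI exI[of _ "\<lambda>t x. \<Sum>i\<in>I. f' i t x"] allI impI)
      (auto intro!: continuous_on_sum DERIV_sum)
qed

lemma half_space_slice_continuous:
  fixes g :: "real \<Rightarrow> real ^ 'n \<Rightarrow> real"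
  assumes "continuous_on ({0..} \<times> UNIV) (\<lambda>p. g (fst p) (snd p))" and "t \<ge> 0"
  shows "continuous_on A (g t)"
  using continuous_on_compose2[OF assms(1) continuous_on_Pair[OF continuous_on_const continuous_on_id]]
    assms(2) by fastforce

text \<open>Leibniz rule over the compact cell. The time set \<open>{0..}\<close> is convex and
  contains 0, so the initial time is included, with a one-sided derivative.\<close>

lemma t_C1_integral_differentiable:
  fixes g :: "real \<Rightarrow> real ^ 'n \<Rightarrow> real"
  assumes "t_C1 g" and "t \<ge> 0"
  shows "(\<lambda>s. integral (torus_cell L) (g s)) differentiable (at t within {0..})"
proof -
  obtain g' where c: "continuous_on ({0..} \<times> UNIV) (\<lambda>p. g (fst p) (snd p))"
      "continuous_on ({0..} \<times> UNIV) (\<lambda>p. g' (fst p) (snd p))"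
    and d: "\<And>t x. t \<ge> 0 \<Longrightarrow> ((\<lambda>s. g s x) has_real_derivative g' t x) (at t within {0..})"
    using assms(1) unfolding t_C1_def by blast
  have "((\<lambda>s. integral (torus_cell L) (g s)) has_real_derivative integral (torus_cell L) (g' t))
      (at t within {0..})"
    unfolding torus_cell_def
  proof (rule leibniz_rule_field_derivative)
    show "g s integrable_on cbox 0 (\<chi> i. L)" if "s \<in> {0..}" for s
      using half_space_slice_continuous[OF c(1)] that by (auto intro: integrable_continuous)
    show "continuous_on ({0..} \<times> cbox 0 (\<chi> i. L)) (\<lambda>(t, x). g' t x)"
      unfolding case_prod_unfold by (rule continuous_on_subset[OF c(2)]) auto
  qed (use d assms(2) in auto)
  then show ?thesis
    by (auto simp: has_field_derivative_def differentiable_def)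
qed

text \<open>Brings the integrands of \<open>calF\<close> into the form to which the closure rules
  for \<open>t_C1\<close> apply.\<close>

lemma norm_sq_vec: "(norm (v :: real ^ 'n))\<^sup>2 = (\<Sum>i\<in>UNIV. (v $ i)\<^sup>2)"
  by (simp add: norm_vec_def L2_set_def sum_nonneg)

text \<open>The integrands are sums of squares of components of smooth fields, the last one divided
  by \<theta>, which positivity permits. The case \<open>t = 0\<close> later gives continuity of the
  functional up to the initial time.\<close>

lemma calF_differentiable:
  assumes u: "smooth_field u" and \<theta>: "smooth_field \<theta>"
    and pos: "\<And>t x. t \<ge> 0 \<Longrightarrow> \<theta> t x > 0" and "t \<ge> 0"
  shows "(\<lambda>s. calF L (u s) (dt u s) (\<theta> s)) differentiable (at t within {0..})"
proof -
  have "t_C1 (\<lambda>s x. jacobian_norm_sq (dt u s) x)"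
    unfolding jacobian_norm_sq_def
    by (intro t_C1_sum t_C1_power2 t_C1_smooth_field_nth smooth_field_partial smooth_field_dt u)
  moreover have "t_C1 (\<lambda>s x. (norm (laplacian (u s) x))\<^sup>2)"
    unfolding norm_sq_vec laplacian_def sum_component
    by (intro t_C1_sum t_C1_power2 t_C1_smooth_field_nth smooth_field_partial u)
  moreover have "t_C1 (\<lambda>s x. (norm (grad (\<theta> s) x))\<^sup>2 / \<theta> s x)"
    unfolding norm_sq_vec grad_def vec_lambda_beta
    by (intro t_C1_divide t_C1_sum t_C1_power2 t_C1_smooth_field smooth_field_partial \<theta> pos)
  ultimately show ?thesis
    unfolding calF_def
    using \<open>t \<ge> 0\<close>
    by (intro differentiable_mult differentiable_add differentiable_const)
      (auto intro: t_C1_integral_differentiable)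
qed

section \<open>The Hessian of the square root of the temperature\<close>

lemma partial_eqI: "(f has_derivative f') (at x) \<Longrightarrow> partial i f x = f' (axis i 1)"
  unfolding partial_def using frechet_derivative_at by metis

lemma smooth_field_partial_has_derivative:
  assumes "smooth_field f" and "t \<ge> 0"
  obtains f' where "(f t has_derivative f') (at x)" and "\<And>i. f' (axis i 1) = partial i (f t) x"
  using smooth_field_has_derivative[OF assms, of x] partial_eqI by metis

lemma hessian_sqrt:
  assumes \<theta>: "smooth_field \<theta>" and pos: "\<And>t x. t \<ge> 0 \<Longrightarrow> \<theta> t x > 0" and "t \<ge> 0"
  shows "partial i (partial j (\<lambda>x. sqrt (\<theta> t x))) x =
    partial i (partial j (\<theta> t)) x / (2 * sqrt (\<theta> t x))
    - partial j (\<theta> t) x * partial i (\<theta> t) x / (4 * sqrt (\<theta> t x) * \<theta> t x)"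
proof -
  \<comment> \<open>An equation between functions rather than values at one point, so that it can be
    rewritten under the outer \<open>partial i\<close>.\<close>
  have first: "partial j (\<lambda>x. sqrt (\<theta> t x)) = (\<lambda>x. partial j (\<theta> t) x / (2 * sqrt (\<theta> t x)))"
  proof
    fix x
    obtain f' where f': "(\<theta> t has_derivative f') (at x)"
      and "\<And>i. f' (axis i 1) = partial i (\<theta> t) x"
      using smooth_field_partial_has_derivative[OF \<theta> \<open>t \<ge> 0\<close>] by metis
    moreover have "((\<lambda>x. sqrt (\<theta> t x)) has_derivative (\<lambda>h. f' h / (2 * sqrt (\<theta> t x)))) (at x)"
      using pos[OF \<open>t \<ge> 0\<close>, of x]
      by (auto intro!: derivative_eq_intros f' simp: field_simps)
    ultimately show "partial j (\<lambda>x. sqrt (\<theta> t x)) x = partial j (\<theta> t) x / (2 * sqrt (\<theta> t x))"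
      by (simp add: partial_eqI)
  qed
  obtain f' where f': "(\<theta> t has_derivative f') (at x)"
    and f'_axis: "\<And>i. f' (axis i 1) = partial i (\<theta> t) x"
    using smooth_field_partial_has_derivative[OF \<theta> \<open>t \<ge> 0\<close>] by metis
  obtain f'' where f'': "(partial j (\<theta> t) has_derivative f'') (at x)"
    and f''_axis: "\<And>i. f'' (axis i 1) = partial i (partial j (\<theta> t)) x"
    using smooth_field_partial_has_derivative[OF smooth_field_partial[OF \<theta>] \<open>t \<ge> 0\<close>] by metis
  have sq: "sqrt (\<theta> t x) * sqrt (\<theta> t x) = \<theta> t x" "sqrt (\<theta> t x) > 0"
    using pos[OF \<open>t \<ge> 0\<close>, of x] by auto
  have "((\<lambda>x. partial j (\<theta> t) x / (2 * sqrt (\<theta> t x))) has_derivative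
      (\<lambda>h. f'' h / (2 * sqrt (\<theta> t x))
        - partial j (\<theta> t) x * f' h / (4 * sqrt (\<theta> t x) * \<theta> t x))) (at x)"
    using sq pos[OF \<open>t \<ge> 0\<close>, of x]
    by (auto intro!: derivative_eq_intros f' f'' simp: field_simps)
  from partial_eqI[OF this, of i] show ?thesis
    unfolding first f'_axis f''_axis .
qed

lemma hessian_L2_sq_nonneg: "hessian_L2_sq L f \<ge> 0"
proof (cases "hessian_norm_sq f integrable_on torus_cell L")
  case True
  then show ?thesis
    unfolding hessian_L2_sq_def
    by (rule integral_nonneg) (simp add: hessian_norm_sq_def sum_nonneg)
next
  \<comment> \<open>A non-integrable function has integral 0 by convention.\<close>
  case False
  then show ?thesis
    by (simp add: hessian_L2_sq_def not_integrable_integral)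
qed

text \<open>By \<open>hessian_sqrt\<close> the integrand is jointly continuous, because \<theta>
  does not vanish for \<open>t \<ge> 0\<close>. It is therefore bounded on the compact set of times
  in \<open>{0..T}\<close> and points of the cell, and integrating that bound over the cell gives
  one independent of \<open>t\<close>.\<close>

lemma hessian_L2_sq_sqrt_bounded:
  fixes \<theta> :: "real \<Rightarrow> real ^ 'n \<Rightarrow> real"
  assumes \<theta>: "smooth_field \<theta>" and pos: "\<And>t x. t \<ge> 0 \<Longrightarrow> \<theta> t x > 0"
  shows "\<exists>B. \<forall>t\<in>{0..T}. hessian_L2_sq L (\<lambda>x. sqrt (\<theta> t x)) \<le> B"
proof -
  let ?h = "\<lambda>t x. hessian_norm_sq (\<lambda>x. sqrt (\<theta> t x)) x"
  let ?S = "{0..} \<times> UNIV :: (real \<times> (real ^ 'n)) set"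
  let ?K = "{0..T} \<times> torus_cell L :: (real \<times> (real ^ 'n)) set"
  have nz: "\<theta> t x \<noteq> 0" if "t \<ge> 0" for t x
    using pos[OF that, of x] by simp
  have "continuous_on ?S (\<lambda>p. \<Sum>i\<in>UNIV. \<Sum>j\<in>UNIV.
      (partial i (partial j (\<theta> (fst p))) (snd p) / (2 * sqrt (\<theta> (fst p) (snd p)))
       - partial j (\<theta> (fst p)) (snd p) * partial i (\<theta> (fst p)) (snd p) /
           (4 * sqrt (\<theta> (fst p) (snd p)) * \<theta> (fst p) (snd p)))\<^sup>2)"
    using smooth_field_continuous_on[OF \<theta>]
      smooth_field_continuous_on[OF smooth_field_partial[OF \<theta>]]
      smooth_field_continuous_on[OF smooth_field_partial[OF smooth_field_partial[OF \<theta>]]]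
    by (intro continuous_intros) (auto simp: nz)
  then have cont: "continuous_on ?S (\<lambda>p. ?h (fst p) (snd p))"
    by (rule continuous_on_eq) (auto simp: hessian_norm_sq_def hessian_sqrt[OF \<theta> pos])
  have "compact ?K"
    unfolding torus_cell_def by (intro compact_Times compact_cbox compact_Icc)
  moreover have "continuous_on ?K (\<lambda>p. ?h (fst p) (snd p))"
    by (rule continuous_on_subset[OF cont]) auto
  ultimately have "bounded ((\<lambda>p. ?h (fst p) (snd p)) ` ?K)"
    using compact_continuous_image compact_imp_bounded by blast
  then obtain B where B: "\<And>p. p \<in> ?K \<Longrightarrow> \<bar>?h (fst p) (snd p)\<bar> \<le> B"
    unfolding bounded_iff real_norm_def by blast
  show ?thesis
  proof (intro exI ballI)
    fix t assume t: "t \<in> {0..T}"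
    have "?h t integrable_on torus_cell L"
      unfolding torus_cell_def
      using half_space_slice_continuous[OF cont] t by (intro integrable_continuous) auto
    moreover have "(\<lambda>x. B) integrable_on (torus_cell L :: (real ^ 'n) set)"
      unfolding torus_cell_def by (rule integrable_const)
    moreover have "?h t x \<le> B" if "x \<in> torus_cell L" for x
      using B[of "(t, x)"] t that by auto
    ultimately show "hessian_L2_sq L (\<lambda>x. sqrt (\<theta> t x))
        \<le> integral (torus_cell L :: (real ^ 'n) set) (\<lambda>x. B)"
      unfolding hessian_L2_sq_def by (rule integral_le)
  qed
qed

section \<open>Gronwall's inequality and monotonicity of the functional\<close>

text \<open>If \<open>G T > 0\<close>, take the last time \<open>s\<close> with
  \<open>G s \<le> 0\<close>. Beyond \<open>s\<close> the function \<open>G\<close> is positive, so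
  an upper bound \<open>A\<close> on \<open>a\<close> suffices to get \<open>G' \<le> A * G\<close>
  there, and \<open>exp (- A * t) * G t\<close> cannot rise from a nonpositive value to a positive
  one.\<close>

lemma Gronwall_nonpos:
  fixes G a :: "real \<Rightarrow> real"
  assumes cont: "continuous_on {0..T} G"
    and deriv: "\<And>t. 0 < t \<Longrightarrow> t < T \<Longrightarrow> \<exists>y. DERIV G t :> y \<and> y \<le> a t * G t"
    and a: "\<And>t. 0 < t \<Longrightarrow> t < T \<Longrightarrow> a t \<le> A"
    and "G 0 \<le> 0" and "0 \<le> T"
  shows "G T \<le> 0"
proof (rule ccontr)
  assume "\<not> G T \<le> 0"
  define Z where "Z = {t \<in> {0..T}. G t \<le> 0}"
  \<comment> \<open>Closedness makes the supremum of \<open>Z\<close> an element of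
    \<open>Z\<close>, so that \<open>G\<close> is nonpositive at the last such time itself.\<close>
  have "closed Z"
    unfolding Z_def using continuous_closed_preimage[OF cont closed_atLeastAtMost closed_atMost, of 0]
    by (simp add: vimage_def Int_def)
  moreover have "0 \<in> Z" "bdd_above Z"
    using assms by (auto simp: Z_def bdd_above_def)
  ultimately have "Sup Z \<in> Z"
    using closed_contains_Sup by blast
  define s where "s = Sup Z"
  have s: "0 \<le> s" "s \<le> T" "G s \<le> 0"
    using \<open>Sup Z \<in> Z\<close> by (auto simp: Z_def s_def)
  have positive: "G t > 0" if "s < t" "t \<le> T" for t
  proof (rule ccontr)
    assume "\<not> G t > 0"
    then have "t \<in> Z"
      using that s by (auto simp: Z_def)
    then show False
      using cSup_upper[OF _ \<open>bdd_above Z\<close>] that by (force simp: s_def)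
  qed
  \<comment> \<open>The integrating factor turns \<open>G' \<le> A * G\<close> into a nonpositive
    derivative on the open interval from \<open>s\<close> to \<open>T\<close>.\<close>
  have "exp (- A * T) * G T \<le> exp (- A * s) * G s"
  proof (rule DERIV_nonpos_imp_decreasing_open[OF s(2)])
    fix t assume t: "s < t" "t < T"
    with s obtain y where y: "DERIV G t :> y" "y \<le> a t * G t"
      using deriv[of t] by auto
    have "a t * G t \<le> A * G t"
      using a[of t] positive[of t] t s by (intro mult_right_mono) auto
    moreover have "DERIV (\<lambda>t. exp (- A * t) * G t) t :> exp (- A * t) * (y - A * G t)"
      by (auto intro!: derivative_eq_intros y simp: algebra_simps)
    ultimately show "\<exists>y. DERIV (\<lambda>t. exp (- A * t) * G t) t :> y \<and> y \<le> 0"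
      using y by (auto simp: mult_le_0_iff intro!: exI)
  qed (auto intro!: continuous_intros continuous_on_subset[OF cont] intro: order_trans[OF s(1)])
  also have "\<dots> \<le> 0"
    using s by (simp add: mult_le_0_iff)
  finally show False
    using \<open>\<not> G T \<le> 0\<close> by (simp add: mult_le_0_iff)
qed

theorem corollary3p7:
  fixes L \<mu> D :: real
    and u :: "real \<Rightarrow> real ^ 'n \<Rightarrow> real ^ 'n" and \<theta> :: "real \<Rightarrow> real ^ 'n \<Rightarrow> real"
    and u\<^sub>0 v\<^sub>0 :: "real ^ 'n \<Rightarrow> real ^ 'n" and \<theta>\<^sub>0 :: "real ^ 'n \<Rightarrow> real"
  assumes "CARD('n) \<in> {2, 3}" and "L > 0" and "\<mu> > 0"
    and "admissible_threshold TYPE('n) L \<mu> D"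
    and "smooth_positive_solution L \<mu> u \<theta>"
    and "u 0 = u\<^sub>0" and "dt u 0 = v\<^sub>0" and "\<theta> 0 = \<theta>\<^sub>0"
  shows "calF L u\<^sub>0 v\<^sub>0 \<theta>\<^sub>0 \<le> D \<longrightarrow>
    (\<forall>t>0. calF L (u t) (dt u t) (\<theta> t) \<le> calF L u\<^sub>0 v\<^sub>0 \<theta>\<^sub>0)"
proof (intro impI allI)
  fix T :: real
  assume init: "calF L u\<^sub>0 v\<^sub>0 \<theta>\<^sub>0 \<le> D" and "T > 0"
  define F where "F = (\<lambda>t. calF L (u t) (dt u t) (\<theta> t))"
  define H where "H = (\<lambda>t. hessian_L2_sq L (\<lambda>x. sqrt (\<theta> t x)))"
  have u: "smooth_field u" and \<theta>: "smooth_field \<theta>" and pos: "\<And>t x. t \<ge> 0 \<Longrightarrow> \<theta> t x > 0"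
    using assms(5)
    unfolding smooth_positive_solution_def smooth_torus_field_def smooth_field_def by auto
  obtain C where "C > 0" and C: "\<And>t. t > 0 \<Longrightarrow> deriv F t \<le> C * H t * (F t - D)"
    using assms(4,5) unfolding admissible_threshold_def F_def H_def by blast
  have diff: "F differentiable (at t within {0..})" if "t \<ge> 0" for t
    unfolding F_def by (rule calF_differentiable[OF u \<theta> pos that])
  have DERIV_F: "DERIV F t :> deriv F t" if "t > 0" for t
  proof -
    have "at t within {0..} = at t"
      \<comment> \<open>\<open>-1\<close> is just some point below the endpoint 0, as
        \<open>interior_Ici\<close> demands. At positive times the one-sided derivative is thus
        two-sided, and \<open>deriv\<close> is its value.\<close>
      using that by (intro at_within_interior) (simp add: interior_Ici[where b = "-1"])
    then show ?thesis
      using diff[of t] that DERIV_deriv_iff_real_differentiable by auto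
  qed
  have "continuous_on {0..} F"
    using diff by (intro differentiable_imp_continuous_on) (simp add: differentiable_on_def)
  then have cont: "continuous_on {0..t} F" for t
    by (rule continuous_on_subset) auto
  have CH: "C * H t \<ge> 0" for t
    unfolding H_def using \<open>C > 0\<close> by (intro mult_nonneg_nonneg hessian_L2_sq_nonneg) simp
  have below: "F t - D \<le> 0" if "t \<ge> 0" for t
  proof -
    \<comment> \<open>The bound \<open>B\<close> may grow with \<open>t\<close>; this is harmless,
      since Gronwall's inequality is applied on each \<open>{0..t}\<close> separately and its
      conclusion does not involve \<open>B\<close>.\<close>
    obtain B where B: "\<And>s. s \<in> {0..t} \<Longrightarrow> H s \<le> B"
      using hessian_L2_sq_sqrt_bounded[OF \<theta> pos] unfolding H_def by metis
    show ?thesis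
    proof (rule Gronwall_nonpos[of t "\<lambda>t. F t - D" "\<lambda>t. C * H t" "C * B"])
      show "continuous_on {0..t} (\<lambda>t. F t - D)"
        by (intro continuous_intros cont)
      show "\<exists>y. DERIV (\<lambda>t. F t - D) s :> y \<and> y \<le> C * H s * (F s - D)" if "0 < s" for s
        using DERIV_diff[OF DERIV_F[OF that] DERIV_const[of D]] C[OF that] by auto
      show "C * H s \<le> C * B" if "0 < s" "s < t" for s
        using B[of s] that \<open>C > 0\<close> by simp
      show "F 0 - D \<le> 0"
        using init assms by (simp add: F_def)
    qed fact
  qed
  \<comment> \<open>With \<open>F t \<le> D\<close> at all times, the right-hand side
    \<open>C * H t * (F t - D)\<close> is a nonnegative factor times a nonpositive one.\<close>
  have "F T \<le> F 0"
  proof (rule DERIV_nonpos_imp_decreasing_open[where f = F])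
    fix t assume "0 < t" "t < T"
    then have "deriv F t \<le> 0"
      using C[of t] below[of t] CH[of t] by (smt (verit) mult_nonneg_nonpos)
    then show "\<exists>y. DERIV F t :> y \<and> y \<le> 0"
      using DERIV_F \<open>0 < t\<close> by blast
  qed (use \<open>T > 0\<close> cont in auto)
  then show "calF L (u T) (dt u T) (\<theta> T) \<le> calF L u\<^sub>0 v\<^sub>0 \<theta>\<^sub>0"
    using assms by (simp add: F_def)
qed

end
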